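(* (a) For every positive integer $m$ and every $\alpha$ with $1-\frac{1}{2^{m-1}}<\alpha<1$ there is a constant $c=c(m,\alpha)>0$ such that the following holds. Let $X$ be a finite set, let $\mathcal F\subseteq 2^X$ satisfy $|\mathcal F|/2^{|X|}>\alpha$, and let $\mathcal C$ be a collection of $N\ge 2$ constraints on $X$, each of size $m$ and each satisfied by $\mathcal F$. Then there is a subfamily of $\mathcal F$ consisting of at most $c\log_2 N$ sets that satisfies every constraint in $\mathcal C$. (b) This fails at $\alpha=1-\frac1{2^{m-1}}$: for every $m\ge1$ and every $c>0$ there exist a finite set $X$, a family $\mathcal F\subseteq 2^X$ with $|\mathcal F|/2^{|X|}>1-\frac1{2^{m-1}}$, and a collection of $N$ constraints of size $m$, each satisfied by $\mathcal F$, such that no subfamily of $\mathcal F$ of at most $c\log_2 N$ sets satisfies all of them.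
   Context: A constraint on $X$ is a pair $(V,W)$ of disjoint subsets of $X$; its size is $|V\cup W|$. A set $A\subseteq X$ satisfies $(V,W)$ if $V\subseteq A$ and $W\cap A=\emptyset$. A family of subsets of $X$ satisfies a constraint if some member of the family satisfies it. *)

theory Defs
  imports Complex_Main "HOL-Library.Infinite_Typeclass"
begin

(* Ground sets are finite subsets of a type of class infinite, so that every finite set embeds
   in the type and arbitrarily large ones exist. *)

type_synonym 'a constr = "'a set \<times> 'a set"

definition constraint_on :: "'a set \<Rightarrow> 'a constr \<Rightarrow> bool" where
  "constraint_on X C \<longleftrightarrow> fst C \<subseteq> X \<and> snd C \<subseteq> X \<and> fst C \<inter> snd C = {}"

definition constr_size :: "'a constr \<Rightarrow> nat" where
  "constr_size C = card (fst C \<union> snd C)"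

definition set_satisfies :: "'a set \<Rightarrow> 'a constr \<Rightarrow> bool" where
  "set_satisfies A C \<longleftrightarrow> fst C \<subseteq> A \<and> snd C \<inter> A = {}"

definition family_satisfies :: "'a set set \<Rightarrow> 'a constr \<Rightarrow> bool" where
  "family_satisfies F C \<longleftrightarrow> (\<exists>A\<in>F. set_satisfies A C)"

end

theory Submission
  imports Defs
begin

text \<open>
  Part (a). Call a constraint bad if at most a fraction \<open>\<delta>\<close> of all subsets of \<open>X\<close> lies in
  \<open>F\<close> and satisfies it. The good constraints are handled greedily by \<open>O(log N)\<close> sets. The bad ones
  are bounded in number: the cubes of satisfying sets of \<open>k\<close> bad constraints cover a fraction of at
  most \<open>k \<delta> + (1 - \<alpha>)\<close>, which is less than \<open>2 / 2 ^ m\<close>. So no two bad cubes are disjoint, and all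
  bad constraints agree with one set \<open>Z\<close> on their supports. If there were many, the
  Erdos--Rado lemma would give \<open>k\<close> supports forming a sunflower with a kernel of size \<open>s < m\<close>, whose
  cubes cover a fraction tending to \<open>1 / 2 ^ s \<ge> 2 / 2 ^ m\<close> as \<open>k\<close> grows, a contradiction.

  Part (b). Fix \<open>S\<close> of size \<open>m - 1\<close>; let \<open>F\<close> consist of all sets not containing \<open>S\<close> and of the sets
  \<open>insert x S\<close>. Each constraint \<open>(insert x S, {})\<close> is satisfied only by \<open>insert x S\<close>.
\<close>

section \<open>Sunflower lemma of Erdos and Rado\<close>

text \<open>Induction on \<open>m\<close>. A maximal pairwise disjoint subfamily either has
  \<open>k\<close> members, which form a sunflower with empty kernel, or has a small union meeting
  every member of the family. In the latter case some point \<open>x\<close> lies in many members;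
  the induction hypothesis is applied to these with \<open>x\<close> removed, and \<open>x\<close>
  then joins the kernel. The strict inclusion \<open>S \<subset> U\<close> is recorded because it
  later yields \<open>card S < m\<close>.\<close>

lemma sunflower:
  fixes \<U> :: "'a set set"
  assumes "finite \<U>" "\<And>U. U \<in> \<U> \<Longrightarrow> finite U \<and> card U = m" "card \<U> > k ^ m * fact m"
  shows "\<exists>S \<T>. \<T> \<subseteq> \<U> \<and> card \<T> = k \<and> (\<forall>U\<in>\<T>. S \<subset> U) \<and> pairwise (\<lambda>U U'. U \<inter> U' = S) \<T>"
  using assms
proof (induction m arbitrary: \<U>)
  case 0
  have "\<U> \<subseteq> {{}}" using 0(2) by fastforce
  then have "card \<U> \<le> 1" using card_mono[of "{{}}" \<U>] by simp
  then show ?case using 0(3) by simp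
next
  case (Suc m)
  define D where "D = {\<T>. \<T> \<subseteq> \<U> \<and> pairwise disjnt \<T>}"
  have finD: "finite D" unfolding D_def using Suc.prems(1) by simp
  have "{} \<in> D" by (simp add: D_def)
  then obtain M where M: "M \<in> D" "\<And>\<T>. \<T> \<in> D \<Longrightarrow> M \<subseteq> \<T> \<Longrightarrow> M = \<T>"
    using finite_has_maximal[OF finD] by blast
  show ?case
  proof (cases "k \<le> card M")
    case True
    then obtain \<T> where T: "\<T> \<subseteq> M" "card \<T> = k" by (meson obtain_subset_with_card_n)
    have sub: "\<T> \<subseteq> \<U>" using M(1) T unfolding D_def by auto
    have "pairwise disjnt \<T>" using M(1) T(1) unfolding D_def by (auto intro: pairwise_subset)
    then have "pairwise (\<lambda>U U'. U \<inter> U' = {}) \<T>" by (simp add: pairwise_def disjnt_def)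
    moreover have "\<forall>U\<in>\<T>. {} \<subset> U" using Suc.prems(2) sub by fastforce
    ultimately show ?thesis using T(2) sub by blast
  next
    case False
    define H where "H = \<Union>M"
    have Msub: "M \<subseteq> \<U>" using M(1) by (simp add: D_def)
    then have finM: "finite M" using Suc.prems(1) finite_subset by blast
    have finH: "finite H" unfolding H_def using finM Msub Suc.prems(2) by auto
    have "card H \<le> (\<Sum>U\<in>M. card U)" unfolding H_def by (rule card_Union_le_sum_card)
    also have "\<dots> = card M * Suc m" using Msub Suc.prems(2) by (simp add: subset_iff)
    also have "\<dots> \<le> k * Suc m" using False by (intro mult_right_mono) auto
    finally have cardH: "card H \<le> k * Suc m" .
    \<comment> \<open>A member disjoint from \<open>H\<close> could be added to \<open>M\<close>. By
      maximality it already belongs to \<open>M\<close>, hence is contained in \<open>H\<close>,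
      hence is empty, against \<open>card U = Suc m\<close>.\<close>
    have hit: "\<exists>x\<in>H. x \<in> U" if "U \<in> \<U>" for U
    proof (rule ccontr)
      assume "\<not> ?thesis"
      then have dis: "U \<inter> H = {}" by auto
      then have "insert U M \<in> D" using M(1) that
        by (auto simp: D_def pairwise_insert disjnt_def H_def)
      then have "U \<in> M" using M(2)[of "insert U M"] by auto
      then have "U = {}" using dis by (auto simp: H_def)
      then show False using Suc.prems(2)[OF that] by simp
    qed
    \<comment> \<open>Pigeonhole: at most \<open>k * Suc m\<close> points of \<open>H\<close> share
      more than \<open>k ^ Suc m * fact (Suc m)\<close> sets.\<close>
    have "\<exists>x\<in>H. card {U\<in>\<U>. x \<in> U} > k ^ m * fact m"
    proof (rule ccontr)
      assume "\<not> ?thesis"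
      then have le: "card {U\<in>\<U>. x \<in> U} \<le> k ^ m * fact m" if "x \<in> H" for x
        using that by force
      have "\<U> \<subseteq> (\<Union>x\<in>H. {U\<in>\<U>. x \<in> U})" using hit by auto
      then have "card \<U> \<le> card (\<Union>x\<in>H. {U\<in>\<U>. x \<in> U})"
        using Suc.prems(1) finH by (intro card_mono) auto
      also have "\<dots> \<le> (\<Sum>x\<in>H. card {U\<in>\<U>. x \<in> U})" by (rule card_UN_le[OF finH])
      also have "\<dots> \<le> card H * (k ^ m * fact m)" using sum_bounded_above[of H, OF le] by simp
      also have "\<dots> \<le> (k * Suc m) * (k ^ m * fact m)" using cardH by (rule mult_right_mono) simp
      also have "\<dots> = k ^ Suc m * fact (Suc m)" by (simp add: algebra_simps)
      finally show False using Suc.prems(3) by linarith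
    qed
    then obtain x where x: "card {U\<in>\<U>. x \<in> U} > k ^ m * fact m" by blast
    define \<V> where "\<V> = (\<lambda>U. U - {x}) ` {U\<in>\<U>. x \<in> U}"
    have "inj_on (\<lambda>U. U - {x}) {U\<in>\<U>. x \<in> U}" by (auto simp: inj_on_def)
    then have "card \<V> > k ^ m * fact m" using x unfolding \<V>_def by (simp add: card_image)
    moreover have "finite \<V>" using Suc.prems(1) by (simp add: \<V>_def)
    moreover have "finite U \<and> card U = m" if "U \<in> \<V>" for U
      using that Suc.prems(2) by (auto simp: \<V>_def)
    ultimately obtain S \<T> where ST: "\<T> \<subseteq> \<V>" "card \<T> = k" "\<forall>U\<in>\<T>. S \<subset> U"
      "pairwise (\<lambda>U U'. U \<inter> U' = S) \<T>" using Suc.IH[of \<V>] by blast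
    have nx: "x \<notin> U" if "U \<in> \<T>" for U using that ST(1) by (auto simp: \<V>_def)
    have "inj_on (insert x) \<T>" using nx by (meson inj_onI insert_ident)
    then have "card (insert x ` \<T>) = k" using ST(2) by (simp add: card_image)
    moreover have "insert x ` \<T> \<subseteq> \<U>" using ST(1) by (auto simp: \<V>_def insert_absorb)
    moreover have "\<forall>U\<in>insert x ` \<T>. insert x S \<subset> U"
    proof
      fix U' assume "U' \<in> insert x ` \<T>"
      then obtain U where "U \<in> \<T>" "U' = insert x U" by blast
      then show "insert x S \<subset> U'" using ST(3) nx[of U] by auto
    qed
    moreover have "pairwise (\<lambda>U U'. U \<inter> U' = insert x S) (insert x ` \<T>)"
    proof (rule pairwiseI)
      fix V V' assume "V \<in> insert x ` \<T>" "V' \<in> insert x ` \<T>" "V \<noteq> V'"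
      then obtain U U' where "U \<in> \<T>" "U' \<in> \<T>" "U \<noteq> U'" "V = insert x U" "V' = insert x U'"
        by blast
      then show "V \<inter> V' = insert x S" using pairwiseD[OF ST(4), of U U'] by simp
    qed
    ultimately show ?thesis by blast
  qed
qed

section \<open>Counting subsets with prescribed traces\<close>

text \<open>The traces of a subset on \<open>Y\<close> and on \<open>X - Y\<close> can be chosen
  independently. Every independence argument below rests on this product formula.\<close>

lemma card_subsets_split:
  assumes "finite X" "Y \<subseteq> X"
  shows "card {A\<in>Pow X. \<phi> (A \<inter> Y) \<and> \<psi> (A - Y)} =
    card {B\<in>Pow Y. \<phi> B} * card {B\<in>Pow (X - Y). \<psi> B}"
proof -
  have "bij_betw (\<lambda>A. (A \<inter> Y, A - Y)) {A\<in>Pow X. \<phi> (A \<inter> Y) \<and> \<psi> (A - Y)}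
    ({B\<in>Pow Y. \<phi> B} \<times> {B\<in>Pow (X - Y). \<psi> B})"
  proof (rule bij_betw_byWitness[where f' = "\<lambda>(B, B'). B \<union> B'"], goal_cases)
    case 1
    then show ?case by auto
  next
    case 2
    have "(B \<union> B') \<inter> Y = B \<and> (B \<union> B') - Y = B'" if "B \<subseteq> Y" "B' \<subseteq> X - Y" for B B'
      using that by auto
    then show ?case by auto
  next
    case 3
    then show ?case by auto
  next
    case 4
    have "(B \<union> B') \<inter> Y = B \<and> (B \<union> B') - Y = B'" if "B \<subseteq> Y" "B' \<subseteq> X - Y" for B B'
      using that by auto
    then show ?case using assms(2) by auto
  qed
  then show ?thesis by (simp add: bij_betw_same_card card_cartesian_product)
qed

lemma pow_card_Diff:
  assumes "finite X" "Y \<subseteq> X"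
  shows "(2::real) ^ card (X - Y) = 2 ^ card X / 2 ^ card Y"
  using assms by (simp add: card_Diff_subset finite_subset card_mono power_diff)

lemma card_Pow_not:
  assumes "finite X"
  shows "real (card {A\<in>Pow X. \<not> \<phi> A}) = 2 ^ card X - real (card {A\<in>Pow X. \<phi> A})"
proof -
  have fin: "finite {A\<in>Pow X. \<phi> A}" for \<phi>
    by (rule finite_subset[of _ "Pow X"]) (use assms in auto)
  have "card ({A\<in>Pow X. \<not> \<phi> A} \<union> {A\<in>Pow X. \<phi> A}) = card {A\<in>Pow X. \<not> \<phi> A} + card {A\<in>Pow X. \<phi> A}"
    by (rule card_Un_disjoint[OF fin fin]) auto
  moreover have "{A\<in>Pow X. \<not> \<phi> A} \<union> {A\<in>Pow X. \<phi> A} = Pow X" by auto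
  ultimately have "card (Pow X) = card {A\<in>Pow X. \<not> \<phi> A} + card {A\<in>Pow X. \<phi> A}" by simp
  then have "2 ^ card X = card {A\<in>Pow X. \<not> \<phi> A} + card {A\<in>Pow X. \<phi> A}"
    using assms by (simp add: card_Pow)
  then have "(2::real) ^ card X = real (card {A\<in>Pow X. \<not> \<phi> A} + card {A\<in>Pow X. \<phi> A})"
    by (metis of_nat_numeral of_nat_power)
  then show ?thesis by simp
qed

lemma card_cube:
  assumes "finite X" "U \<subseteq> X" "V \<subseteq> U"
  shows "real (card {A\<in>Pow X. A \<inter> U = V}) = 2 ^ card X / 2 ^ card U"
proof -
  have "{B\<in>Pow U. B = V} = {V}" using assms by auto
  then have "card {A\<in>Pow X. A \<inter> U = V} = 2 ^ card (X - U)"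
    using card_subsets_split[OF assms(1,2), of "\<lambda>B. B = V" "\<lambda>_. True"] assms(1)
    by (simp add: card_Pow[unfolded Pow_def])
  then show ?thesis using pow_card_Diff[OF assms(1,2)] by simp
qed

text \<open>For a uniformly random \<open>A\<close>, the traces on disjoint sets \<open>P\<close>
  are independent, and each misses the prescribed value with probability
  \<open>1 - 1 / 2 ^ card P\<close>, at most \<open>1 - 1 / 2 ^ r\<close>. The induction splits off
  one \<open>P\<close> and shrinks the ground set to \<open>X - P\<close>, so \<open>X\<close> has
  to vary.\<close>

lemma card_avoiding_le:
  assumes "finite \<P>" "finite X" "\<And>P. P \<in> \<P> \<Longrightarrow> P \<subseteq> X \<and> card P \<le> r" "pairwise disjnt \<P>"
  shows "real (card {A\<in>Pow X. \<forall>P\<in>\<P>. A \<inter> P \<noteq> Z \<inter> P}) \<le> (1 - 1 / 2 ^ r) ^ card \<P> * 2 ^ card X"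
  using assms
proof (induction \<P> arbitrary: X rule: finite_induct)
  case empty
  then show ?case by (simp add: card_Pow[unfolded Pow_def])
next
  case (insert P \<P>)
  have P: "P \<subseteq> X" "card P \<le> r" using insert.prems by auto
  have dis: "P' \<inter> P = {}" if "P' \<in> \<P>" for P'
    using insert.prems(3) insert.hyps(2) that by (auto simp: pairwise_insert disjnt_def)
  \<comment> \<open>By disjointness from \<open>P\<close>, the conditions at the other members
    depend on \<open>A - P\<close> only, which is the form that \<open>card_subsets_split\<close>
    asks for.\<close>
  have "{A\<in>Pow X. \<forall>P\<in>insert P \<P>. A \<inter> P \<noteq> Z \<inter> P} =
    {A\<in>Pow X. A \<inter> P \<noteq> Z \<inter> P \<and> (\<forall>P'\<in>\<P>. (A - P) \<inter> P' \<noteq> Z \<inter> P')}"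
  proof -
    have "(A - P) \<inter> P' = A \<inter> P'" if "P' \<in> \<P>" for A P' using dis[OF that] by auto
    then show ?thesis by auto
  qed
  then have eq: "card {A\<in>Pow X. \<forall>P\<in>insert P \<P>. A \<inter> P \<noteq> Z \<inter> P} =
      card {B\<in>Pow P. B \<noteq> Z \<inter> P} * card {B\<in>Pow (X - P). \<forall>P'\<in>\<P>. B \<inter> P' \<noteq> Z \<inter> P'}"
    using card_subsets_split[OF insert.prems(1) P(1), of "\<lambda>B. B \<noteq> Z \<inter> P"
        "\<lambda>B. \<forall>P'\<in>\<P>. B \<inter> P' \<noteq> Z \<inter> P'"] by simp
  have finP: "finite P" using P insert.prems(1) finite_subset by blast
  have "{B\<in>Pow P. B \<noteq> Z \<inter> P} = Pow P - {Z \<inter> P}" by auto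
  then have "card {B\<in>Pow P. B \<noteq> Z \<inter> P} = 2 ^ card P - 1"
    using finP by (simp add: card_Pow)
  then have "real (card {B\<in>Pow P. B \<noteq> Z \<inter> P}) = 2 ^ card P - 1" by (simp add: of_nat_diff)
  also have "\<dots> = (1 - 1 / 2 ^ card P) * 2 ^ card P" by (simp add: field_simps)
  also have "\<dots> \<le> (1 - 1 / 2 ^ r) * 2 ^ card P"
    using P(2) by (intro mult_right_mono diff_left_mono divide_left_mono) auto
  finally have 1: "real (card {B\<in>Pow P. B \<noteq> Z \<inter> P}) \<le> (1 - 1 / 2 ^ r) * 2 ^ card P" .
  have "P' \<subseteq> X - P \<and> card P' \<le> r" if "P' \<in> \<P>" for P'
    using insert.prems(2)[of P'] dis[OF that] that by auto
  moreover have "pairwise disjnt \<P>" using insert.prems(3) by (simp add: pairwise_insert)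
  ultimately have 2: "real (card {B\<in>Pow (X - P). \<forall>P'\<in>\<P>. B \<inter> P' \<noteq> Z \<inter> P'})
      \<le> (1 - 1 / 2 ^ r) ^ card \<P> * 2 ^ card (X - P)"
    using insert.IH[of "X - P"] insert.prems(1) by blast
  have "real (card {A\<in>Pow X. \<forall>P\<in>insert P \<P>. A \<inter> P \<noteq> Z \<inter> P}) \<le>
    ((1 - 1 / 2 ^ r) * 2 ^ card P) * ((1 - 1 / 2 ^ r) ^ card \<P> * 2 ^ card (X - P))"
    unfolding eq of_nat_mult by (rule mult_mono[OF 1 2]) auto
  also have "\<dots> = (1 - 1 / 2 ^ r) ^ card (insert P \<P>) * 2 ^ card X"
    using insert.hyps pow_card_Diff[OF insert.prems(1) P(1)] by simp
  finally show ?case .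
qed

text \<open>A random \<open>A\<close> agrees with \<open>Z\<close> on the kernel with probability
  \<open>1 / 2 ^ card S\<close>, at least \<open>2 / 2 ^ m\<close> because
  \<open>card S < m\<close>. Independently, it agrees with \<open>Z\<close> on some petal
  \<open>U - S\<close> unless it fails on all of these disjoint petals. Agreement on the kernel and
  on a petal gives agreement on \<open>U\<close>. Bounding the petal sizes by \<open>m\<close> is
  crude but leaves the limit for large \<open>card \<T>\<close> unchanged.\<close>

lemma card_sunflower_cubes_ge:
  assumes "finite X" "finite \<T>" "\<T> \<noteq> {}" "\<And>U. U \<in> \<T> \<Longrightarrow> U \<subseteq> X \<and> card U = m \<and> S \<subset> U"
    and "pairwise (\<lambda>U U'. U \<inter> U' = S) \<T>"
  shows "2 / 2 ^ m * (1 - (1 - 1 / 2 ^ m) ^ card \<T>) * 2 ^ card X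
    \<le> real (card {A\<in>Pow X. \<exists>U\<in>\<T>. A \<inter> U = Z \<inter> U})"
proof -
  obtain U0 where U0: "U0 \<in> \<T>" using assms(3) by auto
  have SX: "S \<subseteq> X" using assms(4)[OF U0] by auto
  have "card S < m"
    using assms(4)[OF U0] assms(1) by (metis finite_subset psubset_card_mono)
  then have "(2::real) * 2 ^ card S \<le> 2 ^ m"
    using power_increasing[of "Suc (card S)" m "2::real"] by simp
  then have S: "(2::real) / 2 ^ m \<le> 1 / 2 ^ card S" by (simp add: field_simps)
  define \<P> where "\<P> = (\<lambda>U. U - S) ` \<T>"
  have "inj_on (\<lambda>U. U - S) \<T>" using assms(4) by (auto simp: inj_on_def)
  then have cardP: "card \<P> = card \<T>" by (simp add: \<P>_def card_image)
  define Q where "Q = (\<lambda>B. \<forall>P\<in>\<P>. B \<inter> P \<noteq> Z \<inter> P)"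
  have "P \<subseteq> X - S \<and> card P \<le> m" if "P \<in> \<P>" for P
    using that assms(1,4) unfolding \<P>_def
    by (auto dest!: assms(4) intro!: card_mono intro: finite_subset)
  moreover have "pairwise disjnt \<P>"
    using assms(5) unfolding \<P>_def pairwise_def disjnt_def by blast
  ultimately have Q: "real (card {B\<in>Pow (X - S). Q B})
      \<le> (1 - 1 / 2 ^ m) ^ card \<T> * 2 ^ card (X - S)"
    unfolding Q_def cardP[symmetric] using assms(1,2)
    by (intro card_avoiding_le) (auto simp: \<P>_def)
  have nQ: "real (card {B\<in>Pow (X - S). \<not> Q B}) =
      2 ^ card (X - S) - real (card {B\<in>Pow (X - S). Q B})"
    using assms(1) by (intro card_Pow_not) simp
  have p: "(1 - 1 / 2 ^ m :: real) ^ card \<T> \<le> 1" by (intro power_le_one) auto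
  have "(2::real) / 2 ^ m * (1 - (1 - 1 / 2 ^ m) ^ card \<T>) * 2 ^ card X
    \<le> 1 / 2 ^ card S * (1 - (1 - 1 / 2 ^ m) ^ card \<T>) * 2 ^ card X"
    using S p by (intro mult_right_mono) auto
  also have "\<dots> = (1 - (1 - 1 / 2 ^ m) ^ card \<T>) * 2 ^ card (X - S)"
    using pow_card_Diff[OF assms(1) SX] by simp
  also have "\<dots> \<le> real (card {B\<in>Pow (X - S). \<not> Q B})"
    unfolding nQ using Q by (simp add: algebra_simps)
  \<comment> \<open>A factor equal to 1 is inserted: it counts the single admissible trace on
    \<open>S\<close>, so that the product formula can be read backwards.\<close>
  also have "card {B\<in>Pow (X - S). \<not> Q B} =
      card {B\<in>Pow S. B = Z \<inter> S} * card {B\<in>Pow (X - S). \<not> Q B}"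
  proof -
    have "{B\<in>Pow S. B = Z \<inter> S} = {Z \<inter> S}" by auto
    then show ?thesis by simp
  qed
  also have "\<dots> = card {A\<in>Pow X. A \<inter> S = Z \<inter> S \<and> \<not> Q (A - S)}"
    by (rule card_subsets_split[symmetric, OF assms(1) SX])
  also have "\<dots> \<le> card {A\<in>Pow X. \<exists>U\<in>\<T>. A \<inter> U = Z \<inter> U}"
  proof (rule card_mono)
    show "finite {A\<in>Pow X. \<exists>U\<in>\<T>. A \<inter> U = Z \<inter> U}" using assms(1) by simp
    show "{A\<in>Pow X. A \<inter> S = Z \<inter> S \<and> \<not> Q (A - S)} \<subseteq> {A\<in>Pow X. \<exists>U\<in>\<T>. A \<inter> U = Z \<inter> U}"
    proof
      fix A assume A: "A \<in> {A\<in>Pow X. A \<inter> S = Z \<inter> S \<and> \<not> Q (A - S)}"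
      then obtain U where "U \<in> \<T>" "(A - S) \<inter> (U - S) = Z \<inter> (U - S)"
        by (auto simp: Q_def \<P>_def)
      moreover from this A have "A \<inter> U = Z \<inter> U" by blast
      ultimately show "A \<in> {A\<in>Pow X. \<exists>U\<in>\<T>. A \<inter> U = Z \<inter> U}" using A by blast
    qed
  qed
  finally show ?thesis by simp
qed

section \<open>Bounding the number of bad constraints\<close>

text \<open>This turns satisfaction into a prescribed trace on the support, so that the counts of
  subcubes above apply.\<close>

lemma set_satisfies_iff:
  assumes "constraint_on X C"
  shows "set_satisfies A C \<longleftrightarrow> A \<inter> (fst C \<union> snd C) = fst C"
  using assms unfolding constraint_on_def set_satisfies_def by blast

text \<open>The inequality on \<open>k\<close> says that \<open>k\<close> cubes of rarely satisfied
  constraints cover less than a sunflower of \<open>k\<close> cubes must cover. With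
  \<open>2 \<le> k\<close> it also excludes two disjoint cubes, which is what reduces constraints to
  their supports.\<close>

lemma card_rarely_satisfied_le:
  fixes X :: "'a set" and \<alpha> \<delta> :: real
  assumes X: "finite X" and F: "F \<subseteq> Pow X" "real (card F) / 2 ^ card X > \<alpha>"
    and k: "2 \<le> k" "0 \<le> \<delta>"
      "real k * \<delta> + (1 - \<alpha>) < 2 / 2 ^ m * (1 - (1 - 1 / 2 ^ m) ^ k)"
    and B: "\<And>C. C \<in> B \<Longrightarrow> constraint_on X C \<and> constr_size C = m \<and>
      real (card {A\<in>F. set_satisfies A C}) \<le> \<delta> * 2 ^ card X"
  shows "card B \<le> k ^ m * fact m"
proof -
  \<comment> \<open>The union of the cubes is taken in all of \<open>Pow X\<close>, not only in
    \<open>F\<close>, so that the exact sizes of cubes can be used.\<close>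
  define sat where "sat T = {A\<in>Pow X. \<exists>C\<in>T. set_satisfies A C}" for T :: "'a constr set"
  have finF: "finite F" using F(1) X finite_subset by blast
  \<comment> \<open>Inside \<open>F\<close> each constraint contributes at most the fraction
    \<delta>; everything outside \<open>F\<close> amounts to less than
    \<open>1 - \<alpha>\<close>.\<close>
  have upper: "real (card (sat T)) \<le> (real (card T) * \<delta> + (1 - \<alpha>)) * 2 ^ card X"
    if T: "T \<subseteq> B" "finite T" for T
  proof -
    have "sat T \<subseteq> (\<Union>C\<in>T. {A\<in>F. set_satisfies A C}) \<union> (Pow X - F)"
      unfolding sat_def by auto
    then have "card (sat T) \<le> card ((\<Union>C\<in>T. {A\<in>F. set_satisfies A C}) \<union> (Pow X - F))"
      using X T finF by (intro card_mono) auto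
    also have "\<dots> \<le> card (\<Union>C\<in>T. {A\<in>F. set_satisfies A C}) + card (Pow X - F)"
      by (rule card_Un_le)
    also have "\<dots> \<le> (\<Sum>C\<in>T. card {A\<in>F. set_satisfies A C}) + card (Pow X - F)"
      using card_UN_le[OF T(2)] by simp
    finally have "real (card (sat T)) \<le>
        real ((\<Sum>C\<in>T. card {A\<in>F. set_satisfies A C}) + card (Pow X - F))"
      by (rule of_nat_mono)
    then have "real (card (sat T)) \<le>
        (\<Sum>C\<in>T. real (card {A\<in>F. set_satisfies A C})) + real (card (Pow X - F))"
      by simp
    moreover have "(\<Sum>C\<in>T. real (card {A\<in>F. set_satisfies A C})) \<le> real (card T) * (\<delta> * 2 ^ card X)"
      using B T by (intro sum_bounded_above) auto
    moreover have "real (card (Pow X - F)) = 2 ^ card X - real (card F)"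
    proof -
      have "{A\<in>Pow X. \<not> A \<in> F} = Pow X - F" "{A\<in>Pow X. A \<in> F} = F" using F(1) by auto
      then show ?thesis using card_Pow_not[OF X, of "\<lambda>A. A \<in> F"] by simp
    qed
    moreover have "real (card F) \<ge> \<alpha> * 2 ^ card X" using F(2) by (simp add: field_simps)
    ultimately show ?thesis by (simp add: algebra_simps)
  qed
  have p: "(1 - 1 / 2 ^ m :: real) ^ k \<ge> 0" by simp
  have lt: "2 * \<delta> + (1 - \<alpha>) < 2 / 2 ^ m"
  proof -
    have "2 * \<delta> \<le> real k * \<delta>" using k by (intro mult_right_mono) auto
    moreover have "2 / 2 ^ m * (1 - (1 - 1 / 2 ^ m) ^ k) \<le> (2 / 2 ^ m * 1 :: real)"
      using p by (intro mult_left_mono) auto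
    ultimately show ?thesis using k(3) by linarith
  qed
  \<comment> \<open>A point required by \<open>C\<close> and forbidden by \<open>C'\<close> makes
    the two cubes disjoint, so together they cover the fraction \<open>2 / 2 ^ m\<close>,
    contradicting \<open>upper\<close> and \<open>lt\<close>.\<close>
  have compat: "fst C \<inter> snd C' = {}" if C: "C \<in> B" "C' \<in> B" for C C'
  proof (rule ccontr)
    assume ne: "fst C \<inter> snd C' \<noteq> {}"
    have cC: "constraint_on X C" "constraint_on X C'" using B C by auto
    have "C \<noteq> C'" using ne cC by (auto simp: constraint_on_def)
    have cube: "{A\<in>Pow X. set_satisfies A E} = {A\<in>Pow X. A \<inter> (fst E \<union> snd E) = fst E}"
      if "constraint_on X E" for E
      using set_satisfies_iff[OF that] by auto
    have half: "real (card {A\<in>Pow X. set_satisfies A E}) = 2 ^ card X / 2 ^ m" if "E \<in> B" for E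
    proof -
      have "constraint_on X E" "card (fst E \<union> snd E) = m"
        using B[OF that] by (auto simp: constr_size_def)
      then show ?thesis using card_cube[OF X, of "fst E \<union> snd E" "fst E"]
        unfolding cube[OF \<open>constraint_on X E\<close>] by (auto simp: constraint_on_def)
    qed
    have "sat {C, C'} = {A\<in>Pow X. set_satisfies A C} \<union> {A\<in>Pow X. set_satisfies A C'}"
      by (auto simp: sat_def)
    moreover have "{A\<in>Pow X. set_satisfies A C} \<inter> {A\<in>Pow X. set_satisfies A C'} = {}"
      using ne by (auto simp: set_satisfies_def)
    ultimately have "card (sat {C, C'}) =
        card {A\<in>Pow X. set_satisfies A C} + card {A\<in>Pow X. set_satisfies A C'}"
      using X by (simp add: card_Un_disjoint)
    then have "real (card (sat {C, C'})) = 2 / 2 ^ m * 2 ^ card X" using half C by simp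
    moreover have "real (card (sat {C, C'})) \<le> (2 * \<delta> + (1 - \<alpha>)) * 2 ^ card X"
      using upper[of "{C, C'}"] C \<open>C \<noteq> C'\<close> by simp
    ultimately have "2 / 2 ^ m \<le> 2 * \<delta> + (1 - \<alpha>)" by (simp only: mult_le_cancel_right_pos zero_less_power zero_less_numeral)
    then show False using lt by simp
  qed
  define supp where "supp = (\<lambda>C::'a constr. fst C \<union> snd C)"
  \<comment> \<open>By \<open>compat\<close>, no forbidden part meets \<open>Z\<close>, so each
    constraint in \<open>B\<close> is recovered from its support as
    \<open>(Z \<inter> supp C, supp C - Z)\<close>. Hence \<open>supp\<close> is injective on
    \<open>B\<close>, and counting supports counts constraints.\<close>
  define Z where "Z = (\<Union>C\<in>B. fst C)"
  have disjZ: "snd C \<inter> Z = {}" if "C \<in> B" for C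
    using compat[OF _ that] unfolding Z_def by blast
  have fstZ: "fst C = Z \<inter> supp C" if "C \<in> B" for C
    using disjZ[OF that] that unfolding Z_def supp_def by blast
  have sndZ: "snd C = supp C - Z" if "C \<in> B" for C
    using disjZ[OF that] fstZ[OF that] by (auto simp: supp_def)
  have inj: "inj_on supp B"
    by (rule inj_onI) (metis fstZ sndZ prod.collapse)
  have suppX: "supp C \<subseteq> X" "card (supp C) = m" if "C \<in> B" for C
    using B[OF that] by (auto simp: supp_def constraint_on_def constr_size_def)
  show ?thesis
  proof (rule ccontr)
    assume "\<not> ?thesis"
    then have big: "card (supp ` B) > k ^ m * fact m" using inj by (simp add: card_image)
    have "supp ` B \<subseteq> Pow X" using suppX by auto
    then have fin: "finite (supp ` B)" using X finite_subset by blast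
    have "finite U \<and> card U = m" if "U \<in> supp ` B" for U
      using that suppX X finite_subset by blast
    then obtain S \<T> where T: "\<T> \<subseteq> supp ` B" "card \<T> = k" "\<forall>U\<in>\<T>. S \<subset> U"
      "pairwise (\<lambda>U U'. U \<inter> U' = S) \<T>" using sunflower[OF fin _ big] by blast
    obtain T where TB: "T \<subseteq> B" "\<T> = supp ` T" using T(1) by (meson subset_imageE)
    have finT: "finite \<T>" "\<T> \<noteq> {}" using T(2) k(1) by (auto intro: card_ge_0_finite)
    have injT: "inj_on supp T" using inj TB(1) inj_on_subset by blast
    then have cT: "card T = k" "finite T"
      using T(2) TB finT(1) by (auto simp: card_image dest: finite_imageD)
    have "2 / 2 ^ m * (1 - (1 - 1 / 2 ^ m) ^ card \<T>) * 2 ^ card X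
        \<le> real (card {A\<in>Pow X. \<exists>U\<in>\<T>. A \<inter> U = Z \<inter> U})"
    proof (rule card_sunflower_cubes_ge[OF X finT _ T(4)])
      show "U \<subseteq> X \<and> card U = m \<and> S \<subset> U" if "U \<in> \<T>" for U
        using that T(1,3) suppX by blast
    qed
    also have "{A\<in>Pow X. \<exists>U\<in>\<T>. A \<inter> U = Z \<inter> U} = sat T"
    proof -
      have "set_satisfies A C \<longleftrightarrow> A \<inter> supp C = Z \<inter> supp C" if "C \<in> T" for A C
        using set_satisfies_iff[of X C A] B[of C] TB(1) that fstZ[of C]
        by (auto simp: supp_def)
      then show ?thesis unfolding sat_def TB(2) by auto
    qed
    also have "real (card (sat T)) \<le> (real k * \<delta> + (1 - \<alpha>)) * 2 ^ card X"
      using upper[OF TB(1) cT(2)] cT(1) by simp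
    finally have "2 / 2 ^ m * (1 - (1 - 1 / 2 ^ m) ^ k) \<le> real k * \<delta> + (1 - \<alpha>)"
      unfolding T(2) by (simp only: mult_le_cancel_right_pos zero_less_power zero_less_numeral)
    then show False using k(3) by simp
  qed
qed

section \<open>Greedy covering\<close>

text \<open>Double counting of the pairs with \<open>R A C\<close>: on average over
  \<open>F\<close>, a set is related to at least the fraction \<delta> of \<open>\<C>\<close>, so
  some set attains this average.\<close>

lemma greedy_cover_step:
  fixes \<delta> :: real
  assumes "finite \<C>" "finite F" "F \<noteq> {}"
    "\<And>C. C \<in> \<C> \<Longrightarrow> real (card {A\<in>F. R A C}) \<ge> \<delta> * real (card F)"
  shows "\<exists>A\<in>F. real (card {C\<in>\<C>. \<not> R A C}) \<le> (1 - \<delta>) * real (card \<C>)"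
proof (rule ccontr)
  assume "\<not> ?thesis"
  then have gt: "real (card {C\<in>\<C>. \<not> R A C}) > (1 - \<delta>) * real (card \<C>)" if "A \<in> F" for A
    using that by force
  have split: "real (card {C\<in>\<C>. \<not> R A C}) + real (card {C\<in>\<C>. R A C}) = real (card \<C>)" for A
  proof -
    have "card ({C\<in>\<C>. \<not> R A C} \<union> {C\<in>\<C>. R A C}) = card {C\<in>\<C>. \<not> R A C} + card {C\<in>\<C>. R A C}"
      using assms(1) by (intro card_Un_disjoint) auto
    moreover have "{C\<in>\<C>. \<not> R A C} \<union> {C\<in>\<C>. R A C} = \<C>" by auto
    ultimately show ?thesis by simp
  qed
  have "(1 - \<delta>) * real (card \<C>) = real (card \<C>) - \<delta> * real (card \<C>)"
    by (simp add: algebra_simps)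
  then have lt: "real (card {C\<in>\<C>. R A C}) < \<delta> * real (card \<C>)" if "A \<in> F" for A
    using gt[OF that] split[of A] by linarith
  have "real (card F) * (\<delta> * real (card \<C>)) = (\<Sum>C\<in>\<C>. \<delta> * real (card F))" by simp
  also have "\<dots> \<le> (\<Sum>C\<in>\<C>. real (card {A\<in>F. R A C}))" by (rule sum_mono) (rule assms(4))
  also have "\<dots> = real (\<Sum>C\<in>\<C>. card {A\<in>F. R A C})" by simp
  also have "(\<Sum>C\<in>\<C>. card {A\<in>F. R A C}) = (\<Sum>A\<in>F. card {C\<in>\<C>. R A C})"
    by (rule sum_multicount_gen[OF assms(1,2)]) simp
  also have "real (\<Sum>A\<in>F. card {C\<in>\<C>. R A C}) < (\<Sum>A\<in>F. \<delta> * real (card \<C>))"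
    unfolding of_nat_sum using lt assms(2,3) by (intro sum_strict_mono) auto
  finally show False by simp
qed

text \<open>Each round applies the previous step to the elements of \<open>\<C>\<close> still missed
  and leaves at most the fraction \<open>1 - \<delta>\<close> of them.\<close>

lemma greedy_cover:
  fixes \<delta> :: real
  assumes "finite \<C>" "finite F" "F \<noteq> {}" "\<delta> \<le> 1"
    "\<And>C. C \<in> \<C> \<Longrightarrow> real (card {A\<in>F. R A C}) \<ge> \<delta> * real (card F)"
  shows "\<exists>G\<subseteq>F. card G \<le> t \<and>
    real (card {C\<in>\<C>. \<forall>A\<in>G. \<not> R A C}) \<le> (1 - \<delta>) ^ t * real (card \<C>)"
proof (induction t)
  case 0
  show ?case by (rule exI[of _ "{}"]) simp
next
  case (Suc t)
  then obtain G where G: "G \<subseteq> F" "card G \<le> t"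
    "real (card {C\<in>\<C>. \<forall>A\<in>G. \<not> R A C}) \<le> (1 - \<delta>) ^ t * real (card \<C>)" by blast
  obtain A where A: "A \<in> F" "real (card {C\<in>{C\<in>\<C>. \<forall>A\<in>G. \<not> R A C}. \<not> R A C})
      \<le> (1 - \<delta>) * real (card {C\<in>\<C>. \<forall>A\<in>G. \<not> R A C})"
    using greedy_cover_step[of "{C\<in>\<C>. \<forall>A\<in>G. \<not> R A C}" F \<delta> R] assms by auto
  have "{C\<in>{C\<in>\<C>. \<forall>A\<in>G. \<not> R A C}. \<not> R A C} = {C\<in>\<C>. \<forall>A\<in>insert A G. \<not> R A C}" by auto
  moreover have "(1 - \<delta>) * real (card {C\<in>\<C>. \<forall>A\<in>G. \<not> R A C})
      \<le> (1 - \<delta>) * ((1 - \<delta>) ^ t * real (card \<C>))"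
    using G(3) assms(4) by (intro mult_left_mono) auto
  ultimately have "real (card {C\<in>\<C>. \<forall>A\<in>insert A G. \<not> R A C}) \<le> (1 - \<delta>) ^ Suc t * real (card \<C>)"
    using A(2) by simp
  moreover have "card (insert A G) \<le> Suc t"
    using G(2) card_insert_le_m1[of "Suc t" G A] by simp
  ultimately show ?case using A(1) G(1) by blast
qed

text \<open>Since \<open>1 - \<delta> \<le> exp (- \<delta>)\<close>, after
  \<open>t > ln N / \<delta>\<close> rounds fewer than one element is missed, hence none.\<close>

lemma logarithmic_cover:
  fixes \<delta> :: real
  assumes "finite \<C>" "finite F" "F \<noteq> {}" "0 < \<delta>" "\<delta> \<le> 1"
    and "\<And>C. C \<in> \<C> \<Longrightarrow> real (card {A\<in>F. R A C}) \<ge> \<delta> * real (card F)"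
    and "card \<C> \<le> N" "1 \<le> N"
  shows "\<exists>G\<subseteq>F. real (card G) \<le> ln (real N) / \<delta> + 1 \<and> (\<forall>C\<in>\<C>. \<exists>A\<in>G. R A C)"
proof -
  \<comment> \<open>Floor plus one, rather than the ceiling, makes \<open>t\<close> strictly larger
    than \<open>ln N / \<delta>\<close>; the final bound has to be strictly below 1.\<close>
  define t where "t = nat \<lfloor>ln (real N) / \<delta>\<rfloor> + 1"
  have nn: "0 \<le> ln (real N) / \<delta>" using assms by simp
  have t: "ln (real N) / \<delta> < real t" "real t \<le> ln (real N) / \<delta> + 1"
    using nn unfolding t_def by linarith+
  obtain G where G: "G \<subseteq> F" "card G \<le> t"
    "real (card {C\<in>\<C>. \<forall>A\<in>G. \<not> R A C}) \<le> (1 - \<delta>) ^ t * real (card \<C>)"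
    using greedy_cover[of \<C> F \<delta> R t] assms by auto
  have "(1 - \<delta>) ^ t * real (card \<C>) \<le> exp (- \<delta>) ^ t * real N"
    using assms(5,7) exp_ge_add_one_self[of "- \<delta>"] by (intro mult_mono power_mono) auto
  also have "\<dots> = exp (ln (real N) - \<delta> * real t)"
    using assms(8) by (simp add: exp_diff exp_minus field_simps flip: exp_of_nat_mult)
  also have "\<dots> < 1" using t(1) assms(4) by (simp add: field_simps)
  finally have "card {C\<in>\<C>. \<forall>A\<in>G. \<not> R A C} = 0" using G(3) by linarith
  then have "\<forall>C\<in>\<C>. \<exists>A\<in>G. R A C" using assms(1) by auto
  moreover have "real (card G) \<le> ln (real N) / \<delta> + 1" using G(2) t(2) by linarith
  ultimately show ?thesis using G(1) by blast
qed

section \<open>Logarithmically many sets above the threshold density\<close>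

text \<open>The subfamily is a greedy cover of the good constraints together with one witness for
  each bad one. The numbers \<open>k\<close>, \<delta> and \<open>K\<close> depend on
  \<open>m\<close> and \<alpha> only, so the constant is uniform in \<open>X\<close>,
  \<open>F\<close> and \<open>\<C>\<close>.\<close>

lemma few_sets_suffice:
  fixes \<alpha> :: real
  assumes "1 \<le> m" "1 - 1 / 2 ^ (m - 1) < \<alpha>"
  shows "\<exists>c::real. 0 < c \<and>
    (\<forall>(X::'a set) F \<C>. finite X \<longrightarrow> F \<subseteq> Pow X \<longrightarrow> real (card F) / 2 ^ card X > \<alpha> \<longrightarrow>
      card \<C> \<ge> 2 \<longrightarrow>
      (\<forall>C\<in>\<C>. constraint_on X C \<and> constr_size C = m \<and> family_satisfies F C) \<longrightarrow>
      (\<exists>G. G \<subseteq> F \<and> real (card G) \<le> c * log 2 (real (card \<C>)) \<and>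
        (\<forall>C\<in>\<C>. family_satisfies G C)))"
proof -
  have two: "(2::real) / 2 ^ m = 1 / 2 ^ (m - 1)"
    using assms(1) by (cases m) auto
  define q :: real where "q = 1 - 1 / 2 ^ m"
  have q: "0 \<le> q" "q < 1" by (auto simp: q_def)
  have gap: "1 - \<alpha> < 2 / 2 ^ m" using assms(2) two by simp
  \<comment> \<open>The sunflower bound tends to \<open>2 / 2 ^ m = 1 / 2 ^ (m - 1)\<close>, which
    exceeds \<open>1 - \<alpha>\<close> exactly by the density hypothesis; a large \<open>k\<close>
    therefore leaves a positive slack \<open>e\<close>.\<close>
  have "(\<lambda>k. 2 / 2 ^ m * (1 - q ^ k)) \<longlonglongrightarrow> 2 / 2 ^ m * (1 - 0)"
    using q by (intro tendsto_intros LIMSEQ_realpow_zero) auto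
  then have "eventually (\<lambda>k. 1 - \<alpha> < 2 / 2 ^ m * (1 - q ^ k)) sequentially"
    using gap by (intro order_tendstoD(1)) auto
  then obtain k0 where k0: "\<And>k. k \<ge> k0 \<Longrightarrow> 1 - \<alpha> < 2 / 2 ^ m * (1 - q ^ k)"
    by (auto simp: eventually_sequentially)
  define k where "k = max 2 k0"
  have k: "2 \<le> k" "1 - \<alpha> < 2 / 2 ^ m * (1 - q ^ k)" using k0 by (auto simp: k_def)
  define e where "e = 2 / 2 ^ m * (1 - q ^ k) - (1 - \<alpha>)"
  have e: "0 < e" using k(2) by (simp add: e_def)
  \<comment> \<open>The \<open>k\<close> bad constraints together use at most half of the slack
    \<open>e\<close>; the cap at 1 is for \<open>logarithmic_cover\<close>.\<close>
  define \<delta> where "\<delta> = min 1 (e / (2 * real k))"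
  have d: "0 < \<delta>" "\<delta> \<le> 1" using k(1) e by (auto simp: \<delta>_def)
  have "real k * \<delta> \<le> real k * (e / (2 * real k))"
    by (intro mult_left_mono) (auto simp: \<delta>_def)
  also have "\<dots> = e / 2" using k(1) by simp
  also have "\<dots> < e" using e by simp
  finally have kd: "real k * \<delta> + (1 - \<alpha>) < 2 / 2 ^ m * (1 - (1 - 1 / 2 ^ m) ^ k)"
    unfolding e_def q_def by linarith
  define K where "K = k ^ m * fact m"
  \<comment> \<open>The summands pay for the bad constraints, the greedy rounds and the rounding of
    their number. The additive terms are absorbed because \<open>log 2 (card \<C>)\<close> is at
    least 1.\<close>
  define c where "c = real K + 1 / \<delta> + 1"
  show ?thesis
  proof (intro exI[of _ c] conjI allI impI)
    show "0 < c" using d by (simp add: c_def add_nonneg_pos)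
  next
    fix X :: "'a set" and F and \<C> :: "'a constr set"
    assume X: "finite X" and F: "F \<subseteq> Pow X" "real (card F) / 2 ^ card X > \<alpha>" and N: "card \<C> \<ge> 2"
      and C: "\<forall>C\<in>\<C>. constraint_on X C \<and> constr_size C = m \<and> family_satisfies F C"
    have finC: "finite \<C>" using N card.infinite by fastforce
    have finF: "finite F" using F(1) X finite_subset by blast
    have "0 < \<alpha>"
    proof -
      have "1 / 2 ^ (m - 1) \<le> (1::real)" by simp
      then show ?thesis using assms(2) by linarith
    qed
    then have Fne: "F \<noteq> {}" using F(2) by auto
    have cF: "real (card F) \<le> 2 ^ card X"
      using card_mono[OF _ F(1)] X by (simp add: card_Pow)
    \<comment> \<open>Rarity is measured against \<open>2 ^ card X\<close>. As \<open>card F\<close>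
      is no larger, a good constraint is also satisfied by the fraction \<delta> of
      \<open>F\<close>, as the greedy cover requires.\<close>
    define B where "B = {C\<in>\<C>. real (card {A\<in>F. set_satisfies A C}) \<le> \<delta> * 2 ^ card X}"
    have cB: "card B \<le> K" unfolding K_def
      using d by (intro card_rarely_satisfied_le[OF X F k(1) _ kd]) (use C in \<open>auto simp: B_def\<close>)
    have "\<exists>w. \<forall>C\<in>B. w C \<in> F \<and> set_satisfies (w C) C"
      using C by (intro bchoice) (auto simp: B_def family_satisfies_def)
    then obtain w where w: "\<And>C. C \<in> B \<Longrightarrow> w C \<in> F \<and> set_satisfies (w C) C" by blast
    have "\<exists>G\<subseteq>F. real (card G) \<le> ln (real (card \<C>)) / \<delta> + 1 \<and>
        (\<forall>C\<in>\<C> - B. \<exists>A\<in>G. set_satisfies A C)"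
    proof (rule logarithmic_cover[OF _ finF Fne d])
      fix C assume "C \<in> \<C> - B"
      then have "\<delta> * 2 ^ card X \<le> real (card {A\<in>F. set_satisfies A C})" by (auto simp: B_def)
      moreover have "\<delta> * real (card F) \<le> \<delta> * 2 ^ card X"
        using cF d(1) by (intro mult_left_mono) auto
      ultimately show "\<delta> * real (card F) \<le> real (card {A\<in>F. set_satisfies A C})" by linarith
    qed (use finC N in \<open>auto intro: card_mono\<close>)
    then obtain G where G: "G \<subseteq> F" "real (card G) \<le> ln (real (card \<C>)) / \<delta> + 1"
      "\<forall>C\<in>\<C> - B. \<exists>A\<in>G. set_satisfies A C" by blast
    define L where "L = log 2 (real (card \<C>))"
    have L1: "1 \<le> L" unfolding L_def using N by simp
    have "ln (real (card \<C>)) = L * ln 2" by (simp add: L_def log_def)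
    also have "\<dots> \<le> L * 1" using L1 ln_2_less_1 by (intro mult_left_mono) auto
    finally have lnL: "ln (real (card \<C>)) / \<delta> \<le> 1 / \<delta> * L" using d by (simp add: field_simps)
    have "finite B" using finC by (simp add: B_def)
    then have "card (w ` B) \<le> K" using card_image_le[of B w] cB by linarith
    then have "real (card (G \<union> w ` B)) \<le> real (card G) + real K"
      using card_Un_le[of G "w ` B"] by linarith
    also have "\<dots> \<le> 1 / \<delta> * L + 1 + real K" using G(2) lnL by linarith
    also have "\<dots> \<le> 1 / \<delta> * L + L + real K * L"
      using L1 mult_left_mono[OF L1, of "real K"] by simp
    also have "\<dots> = c * L" by (simp add: c_def algebra_simps)
    finally have "real (card (G \<union> w ` B)) \<le> c * log 2 (real (card \<C>))" by (simp add: L_def)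
    moreover have "G \<union> w ` B \<subseteq> F" using G(1) w by auto
    moreover have "\<forall>C\<in>\<C>. family_satisfies (G \<union> w ` B) C"
      using G(3) w unfolding family_satisfies_def by blast
    ultimately show "\<exists>G. G \<subseteq> F \<and> real (card G) \<le> c * log 2 (real (card \<C>)) \<and>
        (\<forall>C\<in>\<C>. family_satisfies G C)" by blast
  qed
qed

section \<open>Failure at the threshold density\<close>

text \<open>The sets not containing \<open>S\<close> have density exactly
  \<open>1 - 1 / 2 ^ (m - 1)\<close>, and the \<open>N\<close> sets \<open>insert x S\<close> raise
  it strictly above. Each of these \<open>N\<close> sets is the only member of \<open>F\<close>
  satisfying its own constraint, so a subfamily satisfying all constraints has at least
  \<open>N\<close> sets.\<close>

lemma threshold_sharp:
  fixes c :: real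
  assumes "1 \<le> m"
  shows "\<exists>(X::'a::infinite set) F \<C>.
    finite X \<and> F \<subseteq> Pow X \<and> real (card F) / 2 ^ card X > 1 - 1 / 2 ^ (m - 1) \<and>
    card \<C> \<ge> 2 \<and>
    (\<forall>C\<in>\<C>. constraint_on X C \<and> constr_size C = m \<and> family_satisfies F C) \<and>
    \<not> (\<exists>G. G \<subseteq> F \<and> real (card G) \<le> c * log 2 (real (card \<C>)) \<and>
      (\<forall>C\<in>\<C>. family_satisfies G C))"
proof -
  have "((\<lambda>N. c / ln 2 * (ln (real N) / real N)) \<longlongrightarrow> c / ln 2 * 0) sequentially"
    by (intro tendsto_intros filterlim_compose[OF ln_x_over_x_tendsto_0 filterlim_real_sequentially])
  then have "((\<lambda>N. c * log 2 (real N) / real N) \<longlongrightarrow> 0) sequentially"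
    by (simp add: log_def)
  then have "eventually (\<lambda>N. c * log 2 (real N) / real N < 1) sequentially"
    by (rule order_tendstoD) simp
  then obtain N0 where N0: "\<And>N. N \<ge> N0 \<Longrightarrow> c * log 2 (real N) / real N < 1"
    by (auto simp: eventually_sequentially)
  \<comment> \<open>Chosen so that \<open>N\<close> exceeds \<open>c * log 2 N\<close>, which is
    possible because \<open>ln N / N\<close> tends to 0.\<close>
  define N where "N = max 2 N0"
  have N: "2 \<le> N" "c * log 2 (real N) < real N"
    using N0[of N] by (auto simp: N_def field_simps)
  obtain X :: "'a set" where X: "finite X" "card X = m - 1 + N"
    using infinite_arbitrarily_large[OF infinite_UNIV] by blast
  obtain S where S: "S \<subseteq> X" "card S = m - 1" "finite S"
    using obtain_subset_with_card_n[of "m - 1" X] X by auto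
  \<comment> \<open>For \<open>m = 1\<close> the set \<open>S\<close> is empty, and \<open>F\<close>
    consists of the singletons of \<open>X\<close>.\<close>
  define F where "F = {A\<in>Pow X. \<not> S \<subseteq> A} \<union> (\<lambda>x. insert x S) ` (X - S)"
  define \<C> where "\<C> = (\<lambda>x. (insert x S, {}::'a set)) ` (X - S)"
  have cXS: "card (X - S) = N" using X S by (simp add: card_Diff_subset)
  have inj: "inj_on (\<lambda>x. insert x S) (X - S)" by (auto simp: inj_on_def)
  then have "inj_on (\<lambda>x. (insert x S, {}::'a set)) (X - S)" by (auto simp: inj_on_def)
  then have cC: "card \<C> = N" using cXS by (simp add: \<C>_def card_image)
  have FX: "F \<subseteq> Pow X" using S by (auto simp: F_def)
  have "real (card {A\<in>Pow X. \<not> S \<subseteq> A}) = 2 ^ card X - real (card {A\<in>Pow X. A \<inter> S = S})"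
    using card_Pow_not[OF X(1), of "\<lambda>A. A \<inter> S = S"] by (simp add: Int_absorb1 inf.absorb_iff2)
  also have "\<dots> = 2 ^ card X - 2 ^ card X / 2 ^ (m - 1)"
    using card_cube[OF X(1) S(1), of S] S(2) by simp
  finally have cA: "real (card {A\<in>Pow X. \<not> S \<subseteq> A}) = (1 - 1 / 2 ^ (m - 1)) * 2 ^ card X"
    by (simp add: algebra_simps)
  have "card F = card {A\<in>Pow X. \<not> S \<subseteq> A} + card ((\<lambda>x. insert x S) ` (X - S))"
    unfolding F_def using X by (intro card_Un_disjoint) auto
  then have "card F = card {A\<in>Pow X. \<not> S \<subseteq> A} + N" using inj cXS by (simp add: card_image)
  then have "real (card F) / 2 ^ card X = (1 - 1 / 2 ^ (m - 1)) + real N / 2 ^ card X"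
    by (simp only: of_nat_add cA add_divide_distrib) simp
  then have dens: "real (card F) / 2 ^ card X > 1 - 1 / 2 ^ (m - 1)"
    using N(1) by simp
  have ok: "\<forall>C\<in>\<C>. constraint_on X C \<and> constr_size C = m \<and> family_satisfies F C"
    using S assms unfolding \<C>_def constraint_on_def constr_size_def family_satisfies_def
      set_satisfies_def F_def by auto
  have no: "\<not> (\<exists>G. G \<subseteq> F \<and> real (card G) \<le> c * log 2 (real (card \<C>)) \<and>
      (\<forall>C\<in>\<C>. family_satisfies G C))"
  proof
    assume "\<exists>G. G \<subseteq> F \<and> real (card G) \<le> c * log 2 (real (card \<C>)) \<and>
      (\<forall>C\<in>\<C>. family_satisfies G C)"
    then obtain G where G: "G \<subseteq> F" "real (card G) \<le> c * log 2 (real N)"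
      "\<forall>C\<in>\<C>. family_satisfies G C" unfolding cC by blast
    \<comment> \<open>A member of \<open>F\<close> containing \<open>insert x S\<close> contains
      \<open>S\<close>, so it is some \<open>insert y S\<close>, and then
      \<open>y = x\<close>.\<close>
    have "insert x S \<in> G" if x: "x \<in> X - S" for x
    proof -
      obtain A where A: "A \<in> G" "insert x S \<subseteq> A"
        using G(3) x by (auto simp: \<C>_def family_satisfies_def set_satisfies_def)
      then have "A \<in> (\<lambda>x. insert x S) ` (X - S)" using G(1) by (auto simp: F_def)
      then have "A = insert x S" using A(2) x by auto
      then show ?thesis using A(1) by simp
    qed
    then have "(\<lambda>x. insert x S) ` (X - S) \<subseteq> G" by auto
    moreover have "finite G" using G(1) FX X(1) by (meson finite_Pow_iff finite_subset)
    ultimately have "N \<le> card G" using inj cXS by (metis card_image card_mono)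
    then show False using G(2) N(2) by linarith
  qed
  show ?thesis
    by (intro exI[of _ X] exI[of _ F] exI[of _ \<C>] conjI X(1) FX dens ok no) (simp add: cC N(1))
qed

theorem theorem4:
  shows
    "(\<forall>(m::nat) (\<alpha>::real). 1 \<le> m \<longrightarrow> 1 - 1 / 2 ^ (m - 1) < \<alpha> \<longrightarrow> \<alpha> < 1 \<longrightarrow>
       (\<exists>c::real. 0 < c \<and>
         (\<forall>(X::'a::infinite set) F \<C>.
            finite X \<longrightarrow> F \<subseteq> Pow X \<longrightarrow> real (card F) / 2 ^ card X > \<alpha> \<longrightarrow>
            card \<C> \<ge> 2 \<longrightarrow>
            (\<forall>C\<in>\<C>. constraint_on X C \<and> constr_size C = m \<and> family_satisfies F C) \<longrightarrow>
            (\<exists>G. G \<subseteq> F \<and> real (card G) \<le> c * log 2 (real (card \<C>)) \<and>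
                 (\<forall>C\<in>\<C>. family_satisfies G C)))))
     \<and>
     (\<forall>(m::nat) (c::real). 1 \<le> m \<longrightarrow> 0 < c \<longrightarrow>
       (\<exists>(X::'a set) F \<C>.
            finite X \<and> F \<subseteq> Pow X \<and> real (card F) / 2 ^ card X > 1 - 1 / 2 ^ (m - 1) \<and>
            card \<C> \<ge> 2 \<and>
            (\<forall>C\<in>\<C>. constraint_on X C \<and> constr_size C = m \<and> family_satisfies F C) \<and>
            \<not> (\<exists>G. G \<subseteq> F \<and> real (card G) \<le> c * log 2 (real (card \<C>)) \<and>
                   (\<forall>C\<in>\<C>. family_satisfies G C))))"
  by (intro conjI allI impI) (rule few_sets_suffice threshold_sharp, assumption+)+

end
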